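(* Let $T$ be a triangle with vertices $y_1,y_2,y_3$, $M$ a point in the interior of $T$, and let $\mathcal{X}_n=\{X_1,\dots,X_n\}$ be iid random points from a continuous distribution $F$ on $T$. If $1\le r_1<r_2\le\infty$, then $\gamma(\mathcal{X}_n,N^{r_2}_{PE},M)$ is stochastically smaller than $\gamma(\mathcal{X}_n,N^{r_1}_{PE},M)$, i.e. $P(\gamma(\mathcal{X}_n,N^{r_2}_{PE},M)\le k)\ge P(\gamma(\mathcal{X}_n,N^{r_1}_{PE},M)\le k)$ for every $k$.
   Context: Let $y_1,y_2,y_3\in\mathbb{R}^2$ be non-collinear, $T$ the closed triangle with these vertices, $e_j$ the edge opposite $y_j$, and $b_j(x)$ the barycentric coordinate of $x\in T$ with respect to $y_j$. For $M$ in the interior of $T$ and $k=1,2,3$, let $M_k$ be the point where the line through $y_k$ and $M$ meets $e_k$; the $M$-vertex region $R_M(y_j)$ is the closed quadrilateral with vertices $y_j,M_k,M,M_l$, $\{j,k,l\}=\{1,2,3\}$. For $x\in T\setminus\{y_1,y_2,y_3\}$ let $v(x)=y_j$ where $x\in R_M(y_j)$ (fixed arbitrary choice on common boundaries). For $r\in[1,\infty)$ and such $x$ with $v(x)=y_j$, the $r$-factor proportional-edge proximity region is $N^r_{PE}(x,M)=\{z\in T: 1-b_j(z)\le r(1-b_j(x))\}$ (the intersection with $T$ of the triangle similar to $T$ with vertex $y_j$ whose opposite side is parallel to $e_j$ at $r$ times the distance from $y_j$ to the line through $x$ parallel to $e_j$); $N^\infty_{PE}(x,M)=T$; $N^r_{PE}(y_j,M)=\{y_j\}$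 for all $r$. The proximity catch digraph on vertex set $\mathcal{X}_n$ has an arc $X_i\to X_j$ ($i\ne j$) iff $X_j\in N^r_{PE}(X_i,M)$; $\gamma(\mathcal{X}_n,N^r_{PE},M)$ denotes its domination number, the minimum cardinality of a set $S\subseteq\mathcal{X}_n$ such that every vertex is in $S$ or is the head of an arc from a vertex of $S$. *)

theory Defs
  imports "HOL-Probability.Probability" "Graph_Theory.Pair_Digraph"
begin

text \<open>The vertices of the triangle are indexed by the three-element type \<open>3\<close>,
  so \<open>{j, k, l} = {1, 2, 3}\<close> reads \<open>{j, k, l} = UNIV\<close>.\<close>

definition closed_triangle :: "(3 \<Rightarrow> real ^ 2) \<Rightarrow> (real ^ 2) set" where
  "closed_triangle y = convex hull (range y)"

definition opposite_edge :: "(3 \<Rightarrow> real ^ 2) \<Rightarrow> 3 \<Rightarrow> (real ^ 2) set" where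
  "opposite_edge y j = convex hull (y ` (UNIV - {j}))"

definition bary :: "(3 \<Rightarrow> real ^ 2) \<Rightarrow> 3 \<Rightarrow> real ^ 2 \<Rightarrow> real" where
  "bary y j x = (THE \<beta> :: 3 \<Rightarrow> real. (\<Sum>i\<in>UNIV. \<beta> i) = 1 \<and> (\<Sum>i\<in>UNIV. \<beta> i *\<^sub>R y i) = x) j"

definition cevian_foot :: "(3 \<Rightarrow> real ^ 2) \<Rightarrow> real ^ 2 \<Rightarrow> 3 \<Rightarrow> real ^ 2" where
  "cevian_foot y M k = (THE p. p \<in> affine hull {y k, M} \<and> p \<in> opposite_edge y k)"

text \<open>For \<open>M\<close> in the interior of the triangle, the quadrilateral with vertices
  \<open>y\<^sub>j\<close>, \<open>M\<^sub>k\<close>, \<open>M\<close>, \<open>M\<^sub>l\<close> is convex, hence equal to the convex hull of its vertices.\<close>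

definition vertex_region :: "(3 \<Rightarrow> real ^ 2) \<Rightarrow> real ^ 2 \<Rightarrow> 3 \<Rightarrow> (real ^ 2) set" where
  "vertex_region y M j = convex hull ({y j, M} \<union> cevian_foot y M ` (UNIV - {j}))"

text \<open>An arbitrary way of resolving ties on the common boundaries of the vertex regions;
  only the values on the triangle minus its vertices are constrained (or used).\<close>

definition vertex_assignment :: "(3 \<Rightarrow> real ^ 2) \<Rightarrow> real ^ 2 \<Rightarrow> (real ^ 2 \<Rightarrow> 3) \<Rightarrow> bool" where
  "vertex_assignment y M v \<longleftrightarrow> (\<forall>x \<in> closed_triangle y - range y. x \<in> vertex_region y M (v x))"

text \<open>The proximity region depends on \<open>M\<close> only through the vertex assignment \<open>v\<close>.\<close>

definition N_PE :: "(3 \<Rightarrow> real ^ 2) \<Rightarrow> (real ^ 2 \<Rightarrow> 3) \<Rightarrow> ereal \<Rightarrow> real ^ 2 \<Rightarrow> (real ^ 2) set" where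
  "N_PE y v r x =
     (if x \<in> range y then {x}
      else if r = \<infinity> then closed_triangle y
      else {z \<in> closed_triangle y. 1 - bary y (v x) z \<le> real_of_ereal r * (1 - bary y (v x) x)})"

definition catch_digraph :: "('a \<Rightarrow> 'a set) \<Rightarrow> 'a set \<Rightarrow> 'a pair_pre_digraph" where
  "catch_digraph N V = \<lparr> pverts = V, parcs = {(x, z). x \<in> V \<and> z \<in> V \<and> x \<noteq> z \<and> z \<in> N x} \<rparr>"

definition dominating_set :: "('a, 'b) pre_digraph \<Rightarrow> 'a set \<Rightarrow> bool" where
  "dominating_set G S \<longleftrightarrow> S \<subseteq> verts G \<and> (\<forall>z \<in> verts G. z \<in> S \<or> (\<exists>s \<in> S. s \<rightarrow>\<^bsub>G\<^esub> z))"

definition domination_number :: "('a, 'b) pre_digraph \<Rightarrow> nat" where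
  "domination_number G = (LEAST k. \<exists>S. finite S \<and> dominating_set G S \<and> card S = k)"

text \<open>Continuity means only that no single point has positive mass; no density is required.\<close>

definition continuous_distribution_on :: "(real ^ 2) set \<Rightarrow> (real ^ 2) measure \<Rightarrow> bool" where
  "continuous_distribution_on T F \<longleftrightarrow>
     prob_space F \<and> sets F = sets borel \<and> emeasure F T = 1 \<and> (\<forall>x. emeasure F {x} = 0)"

text \<open>Sanity checks: the cevian feet are well defined, and whenever \<open>F\<close> has a density, every
  vertex assignment, however irregular on the boundaries, is measurable for the completion of \<open>F\<close>.\<close>

lemma UNIV_3_split:
  fixes l :: 3
  obtains j k where "j \<noteq> l" "k \<noteq> l" "j \<noteq> k" "UNIV = {j, k, l}" "UNIV - {l} = {j, k}"
proof -
  have *: "(UNIV :: 3 set) = {1, 2, 3}"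
    using exhaust_3 by auto
  have d: "(1::3) \<noteq> 2" "(1::3) \<noteq> 3" "(2::3) \<noteq> 3" by auto
  consider "l = 1" | "l = 2" | "l = 3" using exhaust_3 by blast
  then show thesis
  proof cases
    case 1
    have "UNIV = {2, 3, l}" "UNIV - {l} = {2, 3}" unfolding * 1 using d by auto
    then show ?thesis using that[of 2 3] d 1 by simp
  next
    case 2
    have "UNIV = {1, 3, l}" "UNIV - {l} = {1, 3}" unfolding * 2 using d by auto
    then show ?thesis using that[of 1 3] d 2 by simp
  next
    case 3
    have "UNIV = {1, 2, l}" "UNIV - {l} = {1, 2}" unfolding * 3 using d by auto
    then show ?thesis using that[of 1 2] d 3 by simp
  qed
qed

lemma separating_line:
  fixes y :: "3 \<Rightarrow> real ^ 2"
  assumes nc: "\<not> collinear (range y)" and M: "M \<in> interior (closed_triangle y)"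
    and jkl: "UNIV = {j, k, l}" "j \<noteq> l" "k \<noteq> l" "j \<noteq> k"
  obtains a c where "a \<noteq> 0" "a \<bullet> M = c" "a \<bullet> y l = c" "a \<bullet> y j > c" "a \<bullet> y k < c"
proof -
  have r: "range y = {y j, y k, y l}" using jkl(1) by auto
  obtain p q s where pqs: "p > 0" "q > 0" "s > 0" "p + q + s = 1"
      and Meq: "M = p *\<^sub>R y j + q *\<^sub>R y k + s *\<^sub>R y l"
    using M nc interior_convex_hull_3_minimal[of "y j" "y k" "y l"]
    unfolding closed_triangle_def r by auto
  have ex: "\<exists>a :: real ^ 2. a \<noteq> 0 \<and> a \<bullet> (y l - M) = 0"
    using orthogonal_to_vector_exists[of "y l - M"] by (auto simp: orthogonal_def inner_commute)
  then obtain a where a: "a \<noteq> 0" "a \<bullet> (y l - M) = 0" by blast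
  define c where "c = a \<bullet> M"
  have l: "a \<bullet> y l = c" using a(2) by (simp add: c_def inner_diff_right)
  have "c = p * (a \<bullet> y j) + q * (a \<bullet> y k) + s * c"
    using l by (simp add: c_def Meq inner_add_right)
  moreover have "c = p * c + q * c + s * c" using pqs(4) by (simp flip: distrib_right)
  ultimately have bal: "p * (a \<bullet> y j - c) = q * (c - a \<bullet> y k)" by (simp add: algebra_simps)
  have ne: "a \<bullet> y j \<noteq> c"
  proof
    assume j: "a \<bullet> y j = c"
    with bal pqs have k: "a \<bullet> y k = c" by simp
    have "range y \<subseteq> {x. a \<bullet> x = c}" using j k l r by auto
    then have "aff_dim (range y) \<le> aff_dim {x. a \<bullet> x = c}" by (rule aff_dim_subset)
    also have "\<dots> = 1" using a(1) by simp
    finally show False using nc by (simp add: collinear_aff_dim)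
  qed
  show thesis
  proof (cases "a \<bullet> y j > c")
    case True
    then have "q * (c - a \<bullet> y k) > 0" using bal pqs(1) by (metis mult_pos_pos diff_gt_0_iff_gt)
    then have "a \<bullet> y k < c" using pqs(2) by (simp add: zero_less_mult_iff)
    then show ?thesis using that[of a c] a(1) l True c_def by simp
  next
    case False
    then have lt: "a \<bullet> y j < c" using ne by simp
    then have "p * (a \<bullet> y j - c) < 0" using pqs(1) by (simp add: mult_less_0_iff)
    then have "q * (c - a \<bullet> y k) < 0" using bal by simp
    then have "a \<bullet> y k > c" using pqs(2) by (simp add: mult_less_0_iff)
    then show ?thesis using that[of "- a" "- c"] a(1) l lt c_def by simp
  qed
qed

lemma ex1_cevian_foot:
  fixes y :: "3 \<Rightarrow> real ^ 2"
  assumes nc: "\<not> collinear (range y)" and M: "M \<in> interior (closed_triangle y)"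
  shows "\<exists>!p. p \<in> affine hull {y l, M} \<and> p \<in> opposite_edge y l"
proof -
  obtain j k where jkl: "j \<noteq> l" "k \<noteq> l" "j \<noteq> k" "UNIV = {j, k, l}" "UNIV - {l} = {j, k}"
    by (rule UNIV_3_split)
  have r: "range y = {y j, y k, y l}" using jkl(4) by auto
  obtain p q s where pqs: "p > 0" "q > 0" "s > 0" "p + q + s = 1"
      and Meq: "M = p *\<^sub>R y j + q *\<^sub>R y k + s *\<^sub>R y l"
    using M nc interior_convex_hull_3_minimal[of "y j" "y k" "y l"]
    unfolding closed_triangle_def r by auto
  obtain a c where a: "a \<bullet> M = c" "a \<bullet> y l = c" "a \<bullet> y j > c" "a \<bullet> y k < c"
    using separating_line[OF nc M jkl(4,1,2,3)] by blast
  have edge: "opposite_edge y l = {u *\<^sub>R y j + w *\<^sub>R y k | u w. 0 \<le> u \<and> 0 \<le> w \<and> u + w = 1}"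
    by (simp add: opposite_edge_def jkl(5) convex_hull_2)
  have line: "affine hull {y l, M} = {u *\<^sub>R y l + w *\<^sub>R M | u w. u + w = 1}"
    by (simp add: affine_hull_2)
  define t where "t = p + q"
  have t: "t > 0" "s = 1 - t" using pqs by (auto simp: t_def)
  let ?f = "(p / t) *\<^sub>R y j + (q / t) *\<^sub>R y k"
  have "?f = (1 - 1 / t) *\<^sub>R y l + (1 / t) *\<^sub>R M"
  proof -
    have "(1 / t) *\<^sub>R M = (p / t) *\<^sub>R y j + (q / t) *\<^sub>R y k + (s / t) *\<^sub>R y l"
      by (simp add: Meq scaleR_add_right)
    moreover have "s / t = 1 / t - 1" using t by (simp add: field_simps)
    ultimately show ?thesis by (simp add: scaleR_left_diff_distrib)
  qed
  then have f1: "?f \<in> affine hull {y l, M}" unfolding line by force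
  have "p / t + q / t = 1" using t by (simp add: t_def flip: add_divide_distrib)
  then have f2: "?f \<in> opposite_edge y l" unfolding edge using pqs(1,2) t(1)
    by (intro CollectI exI[of _ "p / t"] exI[of _ "q / t"] conjI refl) simp_all
  have uniq: "z = z'" if zz: "z \<in> affine hull {y l, M}" "z \<in> opposite_edge y l"
    "z' \<in> affine hull {y l, M}" "z' \<in> opposite_edge y l" for z z'
  proof -
    have on: "a \<bullet> x = c" if "x \<in> affine hull {y l, M}" for x
      using that a(1,2) unfolding line by (auto simp: inner_add_right simp flip: distrib_right)
    have W: "w = 1 - u" if "u + w = 1" for u w :: real using that by simp
    obtain u where z: "z = u *\<^sub>R y j + (1 - u) *\<^sub>R y k"
      using zz(2) unfolding edge by (blast dest: W)
    obtain u' where z': "z' = u' *\<^sub>R y j + (1 - u') *\<^sub>R y k"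
      using zz(4) unfolding edge by (blast dest: W)
    have "u * (a \<bullet> y j) + (1 - u) * (a \<bullet> y k) = u' * (a \<bullet> y j) + (1 - u') * (a \<bullet> y k)"
      using on[OF zz(1)] on[OF zz(3)] unfolding z z' by (simp add: inner_add_right)
    then have "(u - u') * (a \<bullet> y j - a \<bullet> y k) = 0" by (simp add: algebra_simps)
    then have "u = u'" using a by auto
    then show ?thesis using z z' by simp
  qed
  show ?thesis using f1 f2 uniq by blast
qed

lemma cevian_foot_in:
  assumes "\<not> collinear (range y)" "M \<in> interior (closed_triangle y)"
  shows "cevian_foot y M l \<in> affine hull {y l, M}" "cevian_foot y M l \<in> opposite_edge y l"
  using theI'[OF ex1_cevian_foot[OF assms], of l] unfolding cevian_foot_def by auto

lemma vertex_region_halfplane: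
  fixes y :: "3 \<Rightarrow> real ^ 2"
  assumes nc: "\<not> collinear (range y)" and M: "M \<in> interior (closed_triangle y)"
    and jkl: "UNIV = {j, k, l}" "j \<noteq> l" "k \<noteq> l" "j \<noteq> k"
    and a: "a \<bullet> M = c" "a \<bullet> y l = c" "a \<bullet> y j \<ge> c"
  shows "vertex_region y M j \<subseteq> {x. a \<bullet> x \<ge> c}"
proof -
  have "affine hull {y l, M} \<subseteq> {x. a \<bullet> x = c}"
    using a by (intro hull_minimal affine_hyperplane) auto
  then have l: "a \<bullet> cevian_foot y M l = c"
    using cevian_foot_in(1)[OF nc M, of l] by auto
  have "UNIV - {k} = {j, l}" using jkl by auto
  then have "opposite_edge y k \<subseteq> {x. a \<bullet> x \<ge> c}"
    unfolding opposite_edge_def using a by (intro hull_minimal convex_halfspace_ge) auto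
  then have k: "a \<bullet> cevian_foot y M k \<ge> c"
    using cevian_foot_in(2)[OF nc M, of k] by auto
  have "UNIV - {j} = {k, l}" using jkl by auto
  then show ?thesis
    unfolding vertex_region_def using a l k
    by (intro hull_minimal convex_halfspace_ge) auto
qed

lemma negligible_vertex_region_Int:
  fixes y :: "3 \<Rightarrow> real ^ 2"
  assumes nc: "\<not> collinear (range y)" and M: "M \<in> interior (closed_triangle y)" and "j \<noteq> k"
  shows "negligible (vertex_region y M j \<inter> vertex_region y M k)"
proof -
  obtain l where jkl: "j \<noteq> l" "k \<noteq> l" "UNIV = {j, k, l}"
  proof -
    obtain p q where "p \<noteq> j" "q \<noteq> j" "p \<noteq> q" "UNIV = {p, q, j}" by (rule UNIV_3_split[of j])
    then show thesis using that[of p] that[of q] \<open>j \<noteq> k\<close> by (cases "k = p") auto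
  qed
  obtain a c where a: "a \<noteq> 0" "a \<bullet> M = c" "a \<bullet> y l = c" "a \<bullet> y j > c" "a \<bullet> y k < c"
    using separating_line[OF nc M jkl(3,1,2) assms(3)] by blast
  have "vertex_region y M j \<subseteq> {x. a \<bullet> x \<ge> c}"
    using a by (intro vertex_region_halfplane[OF nc M jkl(3,1,2) assms(3)]) auto
  moreover have "UNIV = {k, j, l}" using jkl(3) by auto
  then have "vertex_region y M k \<subseteq> {x. (- a) \<bullet> x \<ge> - c}"
    using a jkl assms(3) by (intro vertex_region_halfplane[OF nc M, of k j l]) auto
  ultimately have "vertex_region y M j \<inter> vertex_region y M k \<subseteq> {x. a \<bullet> x = c}" by force
  then show ?thesis using a(1) negligible_hyperplane negligible_subset by blast
qed

lemma vertex_assignment_measurable: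
  fixes y :: "3 \<Rightarrow> real ^ 2"
  assumes nc: "\<not> collinear (range y)" and M: "M \<in> interior (closed_triangle y)"
    and v: "vertex_assignment y M v"
    and F: "sets F = sets borel" and ac: "absolutely_continuous lborel F"
  shows "{x \<in> closed_triangle y - range y. v x = j} \<in> sets (completion F)"
proof -
  let ?R = "vertex_region y M" and ?T = "closed_triangle y - range y"
  let ?A = "{x \<in> ?T. v x = j}"
  let ?N = "\<Union>k\<in>UNIV - {j}. ?R j \<inter> ?R k"
  have cl: "closed (?R k)" for k
    unfolding vertex_region_def by (intro compact_imp_closed compact_convex_hull finite_imp_compact) auto
  have clT: "closed (closed_triangle y)"
    unfolding closed_triangle_def by (intro compact_imp_closed compact_convex_hull finite_imp_compact) auto
  have B: "?T \<inter> ?R j \<in> sets F"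
    unfolding F using cl clT by (intro sets.Int sets.Diff borel_closed[OF cl] borel_closed[OF clT] borel_closed[OF finite_imp_closed]) auto
  have "negligible ?N"
  proof (rule negligible_Union)
    fix S assume "S \<in> (\<lambda>k. ?R j \<inter> ?R k) ` (UNIV - {j})"
    then obtain k where "S = ?R j \<inter> ?R k" and "k \<in> UNIV - {j}" by (rule imageE)
    moreover from this have "j \<noteq> k" by blast
    ultimately show "negligible S" using negligible_vertex_region_Int[OF nc M] by simp
  qed simp
  moreover have "?N \<in> sets borel"
    by (intro borel_closed closed_UN ballI closed_Int cl) simp
  ultimately have "?N \<in> null_sets lborel"
    using null_sets_completion_iff[of ?N lborel] by (simp only: negligible_iff_null_sets sets_lborel)
  then have N: "?N \<in> null_sets F" using ac unfolding absolutely_continuous_def by (rule rev_subsetD)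
  have sub: "?T \<inter> ?R j - ?A \<subseteq> ?N"
    using v unfolding vertex_assignment_def by auto
  have D: "?T \<inter> ?R j - ?A \<in> sets (completion F)"
    using null_sets_completion_subset[OF sub null_sets_completionI[OF N]] by (rule null_setsD2)
  have "?T \<inter> ?R j - (?T \<inter> ?R j - ?A) \<in> sets (completion F)"
    by (rule sets.Diff[OF sets_completionI_sets[OF B] D])
  moreover have "?A = ?T \<inter> ?R j - (?T \<inter> ?R j - ?A)"
    using v unfolding vertex_assignment_def by auto
  ultimately show ?thesis by (simp only:)
qed

end

theory Submission
  imports Defs
begin

text \<open>For a point \<open>x\<close> of the triangle other than a vertex, \<open>1 - b\<^sub>j(x) \<ge> 0\<close>, so the proximity region
  of \<open>x\<close> grows with \<open>r\<close>. Almost surely all data points are of this kind, and then every dominating set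
  for \<open>r\<^sub>1\<close> is dominating for \<open>r\<^sub>2\<close>. What remains is the measurability of the event for \<open>r\<^sub>2\<close>,
  which is, up to a null set, a finite Boolean combination of conditions on \<open>v(X\<^sub>i)\<close> and on
  barycentric coordinates, and these are affine on the triangle.\<close>

section \<open>Domination through index sets\<close>

lemma domination_number_catch_digraph_le_iff:
  fixes x :: "'i \<Rightarrow> 'a"
  assumes "finite I"
  shows "domination_number (catch_digraph N (x ` I)) \<le> k \<longleftrightarrow>
    (\<exists>S \<in> Pow I. card S \<le> k \<and> (\<forall>j\<in>I. \<exists>i\<in>S. x j = x i \<or> x j \<in> N (x i)))"
    (is "domination_number ?G \<le> k \<longleftrightarrow> ?R")
proof -
  have dom: "dominating_set ?G S \<longleftrightarrow>
      S \<subseteq> x ` I \<and> (\<forall>z \<in> x ` I. z \<in> S \<or> (\<exists>s\<in>S. z \<in> N s))" for S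
  proof -
    have "s \<rightarrow>\<^bsub>?G\<^esub> z \<longleftrightarrow> s \<in> x ` I \<and> z \<in> x ` I \<and> s \<noteq> z \<and> z \<in> N s" for s z
      by (simp add: catch_digraph_def)
    moreover have "verts ?G = x ` I" by (simp add: catch_digraph_def)
    ultimately show ?thesis unfolding dominating_set_def by (metis subsetD)
  qed
  let ?Q = "\<lambda>m. \<exists>S. finite S \<and> dominating_set ?G S \<and> card S = m"
  show ?thesis
  proof
    assume le: "domination_number ?G \<le> k"
    \<comment> \<open>The whole vertex set dominates, so the least cardinality is attained.\<close>
    have "?Q (card (x ` I))"
      using assms by (intro exI[of _ "x ` I"]) (auto simp: dom)
    then have "?Q (domination_number ?G)"
      unfolding domination_number_def by (rule LeastI)
    then obtain S where S: "finite S" "dominating_set ?G S" "card S \<le> k"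
      using le by auto
    have sub: "S \<subseteq> x ` I" using S(2) by (simp add: dom)
    \<comment> \<open>One index is chosen for each point of \<open>S\<close>, so that
      \<open>J\<close> has the same cardinality as \<open>S\<close>.\<close>
    then obtain J where J: "J \<subseteq> I" "inj_on x J" "S = x ` J"
      by (meson subset_image_inj)
    have "card J = card S" using J by (simp add: card_image)
    then show ?R using S J by (intro bexI[of _ J]) (auto simp: dom)
  next
    assume ?R
    then obtain J where J: "J \<subseteq> I" "card J \<le> k" "\<forall>j\<in>I. \<exists>i\<in>J. x j = x i \<or> x j \<in> N (x i)"
      by auto
    have "finite J" using J(1) assms finite_subset by blast
    then have "finite (x ` J)" "card (x ` J) \<le> k"
      using J(2) card_image_le[of J x] by auto
    moreover have "dominating_set ?G (x ` J)" using J by (fastforce simp: dom)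
    ultimately have "domination_number ?G \<le> card (x ` J)"
      unfolding domination_number_def by (intro Least_le) blast
    then show "domination_number ?G \<le> k" using \<open>card (x ` J) \<le> k\<close> by simp
  qed
qed

section \<open>Barycentric coordinates\<close>

lemma sum_UNIV_3_split:
  fixes f :: "3 \<Rightarrow> 'a::comm_monoid_add"
  assumes "UNIV = {j, k, m}" "j \<noteq> m" "k \<noteq> m" "j \<noteq> k"
  shows "sum f UNIV = f j + f k + f m"
  unfolding assms(1) using assms(2-4) by (simp add: add.assoc)

text \<open>The functional is the signed height above the line through the other two vertices,
  scaled to be 1 at \<open>y m\<close>. It yields both the uniqueness of barycentric coordinates and
  their measurability.\<close>

lemma affine_barycentric_coefficient:
  fixes y :: "3 \<Rightarrow> real ^ 2"
  assumes nc: "\<not> collinear (range y)"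
  obtains a :: "3 \<Rightarrow> real ^ 2" and d :: "3 \<Rightarrow> real"
    where "\<And>\<beta> m. (\<Sum>i\<in>UNIV. \<beta> i) = 1 \<Longrightarrow> a m \<bullet> (\<Sum>i\<in>UNIV. \<beta> i *\<^sub>R y i) + d m = \<beta> m"
proof -
  have "\<exists>a d. \<forall>\<beta>. (\<Sum>i\<in>UNIV. \<beta> i) = 1 \<longrightarrow> a \<bullet> (\<Sum>i\<in>UNIV. \<beta> i *\<^sub>R y i) + d = \<beta> m" for m
  proof -
    obtain j k where jk: "j \<noteq> m" "k \<noteq> m" "j \<noteq> k" "UNIV = {j, k, m}"
      by (rule UNIV_3_split[of m])
    note sum_eq = sum_UNIV_3_split[OF jk(4,1,2,3)]
    have "\<exists>a :: real ^ 2. a \<noteq> 0 \<and> a \<bullet> (y k - y j) = 0"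
      using orthogonal_to_vector_exists[of "y k - y j"] by (auto simp: orthogonal_def inner_commute)
    then obtain a where a: "a \<noteq> 0" "a \<bullet> y k = a \<bullet> y j" by (auto simp: inner_diff_right)
    define D where "D = a \<bullet> y m - a \<bullet> y j"
    \<comment> \<open>If \<open>D\<close> vanished, all three vertices would lie on one line with
      normal \<open>a\<close>.\<close>
    have "D \<noteq> 0"
    proof
      assume "D = 0"
      then have "range y \<subseteq> {x. a \<bullet> x = a \<bullet> y j}" 
        unfolding jk(4) using a by (auto simp: D_def)
      then have "aff_dim (range y) \<le> aff_dim {x. a \<bullet> x = a \<bullet> y j}" by (rule aff_dim_subset)
      also have "\<dots> = 1" using a(1) by simp
      finally show False using nc by (simp add: collinear_aff_dim)
    qed
    have "((1 / D) *\<^sub>R a) \<bullet> (\<Sum>i\<in>UNIV. \<beta> i *\<^sub>R y i) + (- (a \<bullet> y j) / D) = \<beta> m"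
      if "(\<Sum>i\<in>UNIV. \<beta> i) = 1" for \<beta>
    proof -
      have s: "\<beta> j + \<beta> k + \<beta> m = 1" using that by (simp add: sum_eq)
      have "a \<bullet> (\<Sum>i\<in>UNIV. \<beta> i *\<^sub>R y i) = (\<beta> j + \<beta> k) * (a \<bullet> y j) + \<beta> m * (a \<bullet> y m)"
        using a(2) by (simp add: sum_eq algebra_simps)
      also have "\<beta> j + \<beta> k = 1 - \<beta> m" using s by simp
      finally have "a \<bullet> (\<Sum>i\<in>UNIV. \<beta> i *\<^sub>R y i) - a \<bullet> y j = \<beta> m * D"
        by (simp add: D_def algebra_simps)
      then show ?thesis using \<open>D \<noteq> 0\<close> by (simp add: field_simps)
    qed
    then show ?thesis by blast
  qed
  then show thesis using that by metis
qed

text \<open>The affine functionals recover the coefficients from the point, so the description in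
  \<open>bary\<close> has a unique solution.\<close>

lemma bary_eq:
  fixes y :: "3 \<Rightarrow> real ^ 2"
  assumes nc: "\<not> collinear (range y)" and \<beta>: "(\<Sum>i\<in>UNIV. \<beta> i) = 1"
  shows "bary y m (\<Sum>i\<in>UNIV. \<beta> i *\<^sub>R y i) = \<beta> m"
proof -
  obtain a d where ad: "\<And>\<beta> m. (\<Sum>i\<in>UNIV. \<beta> i) = 1 \<Longrightarrow>
      a m \<bullet> (\<Sum>i\<in>UNIV. \<beta> i *\<^sub>R y i) + d m = \<beta> m"
    using affine_barycentric_coefficient[OF nc] by blast
  have "(THE \<beta>'. (\<Sum>i\<in>UNIV. \<beta>' i) = 1 \<and>
      (\<Sum>i\<in>UNIV. \<beta>' i *\<^sub>R y i) = (\<Sum>i\<in>UNIV. \<beta> i *\<^sub>R y i)) = \<beta>"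
  proof (rule the_equality)
    fix \<beta>' assume "(\<Sum>i\<in>UNIV. \<beta>' i) = 1 \<and> (\<Sum>i\<in>UNIV. \<beta>' i *\<^sub>R y i) = (\<Sum>i\<in>UNIV. \<beta> i *\<^sub>R y i)"
    then have "\<beta>' m = \<beta> m" for m using ad[of \<beta>' m] ad[of \<beta> m] \<beta> by simp
    then show "\<beta>' = \<beta>" by (rule ext)
  qed (simp add: \<beta>)
  then show ?thesis by (simp add: bary_def)
qed

lemma closed_triangleE:
  assumes "x \<in> closed_triangle y"
  obtains \<beta> where "\<And>i. 0 \<le> \<beta> i" "(\<Sum>i\<in>UNIV. \<beta> i) = 1" "x = (\<Sum>i\<in>UNIV. \<beta> i *\<^sub>R y i)"
proof -
  have "range y = {y 1, y 2, y 3}" by (simp add: UNIV_3)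
  then obtain u w t where "0 \<le> u" "0 \<le> w" "0 \<le> t" "u + w + t = 1"
      "x = u *\<^sub>R y 1 + w *\<^sub>R y 2 + t *\<^sub>R y 3"
    using assms unfolding closed_triangle_def by (auto simp: convex_hull_3)
  then show thesis
    by (intro that[of "\<lambda>i. if i = 1 then u else if i = 2 then w else t"]) (auto simp: sum_3)
qed

lemma bary_le_1:
  assumes "\<not> collinear (range y)" "x \<in> closed_triangle y"
  shows "bary y m x \<le> 1"
proof -
  obtain \<beta> where \<beta>: "\<And>i. 0 \<le> \<beta> i" "(\<Sum>i\<in>UNIV. \<beta> i) = 1" "x = (\<Sum>i\<in>UNIV. \<beta> i *\<^sub>R y i)"
    using closed_triangleE[OF assms(2)] by blast
  have "\<beta> m \<le> (\<Sum>i\<in>UNIV. \<beta> i)" using \<beta>(1) by (intro member_le_sum) auto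
  then show ?thesis using bary_eq[OF assms(1) \<beta>(2)] \<beta> by simp
qed

text \<open>Replaces \<open>bary\<close>, a definite description, by explicit affine functions that
  measurability rules can handle.\<close>

lemma bary_on_triangle_measurable:
  assumes "\<not> collinear (range y)"
  obtains b :: "3 \<Rightarrow> real ^ 2 \<Rightarrow> real" where "\<And>m. b m \<in> borel_measurable borel"
    "\<And>m x. x \<in> closed_triangle y \<Longrightarrow> bary y m x = b m x"
proof -
  obtain a d where ad: "\<And>\<beta> m. (\<Sum>i\<in>UNIV. \<beta> i) = 1 \<Longrightarrow>
      a m \<bullet> (\<Sum>i\<in>UNIV. \<beta> i *\<^sub>R y i) + d m = \<beta> m"
    using affine_barycentric_coefficient[OF assms] by blast
  show thesis
  proof (rule that[of "\<lambda>m x. a m \<bullet> x + d m"])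
    fix m x assume "x \<in> closed_triangle y"
    then show "bary y m x = a m \<bullet> x + d m"
      using ad bary_eq[OF assms] by (elim closed_triangleE) simp
  qed measurable
qed

section \<open>Monotonicity of the proximity region\<close>

lemma N_PE_mono:
  assumes nc: "\<not> collinear (range y)" and x: "x \<in> closed_triangle y"
    and r: "1 \<le> r1" "r1 \<le> r2"
  shows "N_PE y v r1 x \<subseteq> N_PE y v r2 x"
proof -
  \<comment> \<open>For finite \<open>r2\<close> the bounds force \<open>r1\<close> to be finite
    too, so \<open>real_of_ereal\<close> preserves their order; it would send \<infinity> to
    0.\<close>
  have "real_of_ereal r1 * (1 - bary y (v x) x) \<le> real_of_ereal r2 * (1 - bary y (v x) x)"
    if "r2 \<noteq> \<infinity>"
    using that r bary_le_1[OF nc x, of "v x"]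
    by (cases r1; cases r2) (auto intro: mult_right_mono)
  then show ?thesis using r unfolding N_PE_def by (cases "r2 = \<infinity>") auto
qed

section \<open>Measurability of the arc events\<close>

lemma closed_triangle_borel: "closed_triangle y \<in> sets borel"
  unfolding closed_triangle_def
  by (intro borel_closed compact_imp_closed compact_convex_hull finite_imp_compact) auto

text \<open>The three vertices, where the proximity region degenerates to a point, are null because
  \<open>F\<close> has no atoms.\<close>

lemma continuous_distribution_on_AE:
  assumes "continuous_distribution_on (closed_triangle y) F"
  shows "AE x in F. x \<in> closed_triangle y - range y"
proof -
  interpret prob_space F using assms by (simp add: continuous_distribution_on_def)
  have F: "sets F = sets borel" "emeasure F (closed_triangle y) = 1" "\<And>x. emeasure F {x} = 0"
    using assms by (auto simp: continuous_distribution_on_def)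
  have "AE x in F. x \<in> closed_triangle y"
    using F closed_triangle_borel[of y] by (simp add: AE_in_set_eq_1 measure_def)
  moreover have "AE x in F. \<forall>j. x \<noteq> y j"
  proof (subst AE_all_countable, intro allI)
    fix j
    have "{y j} \<in> null_sets F" using F by (intro null_setsI) auto
    then show "AE x in F. x \<noteq> y j" using AE_not_in by fastforce
  qed
  ultimately show ?thesis by eventually_elim auto
qed

lemma measurable_mem_N_PE:
  fixes y :: "3 \<Rightarrow> real ^ 2" and U V :: "'w \<Rightarrow> real ^ 2"
  assumes nc: "\<not> collinear (range y)"
    and v: "\<And>j. {x \<in> closed_triangle y - range y. v x = j} \<in> sets (completion F)"
    and F: "continuous_distribution_on (closed_triangle y) F"
    and U[measurable]: "U \<in> borel_measurable P" and V[measurable]: "V \<in> borel_measurable P"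
    and dU: "distr P borel U = F" and dV: "distr P borel V = F"
  shows "{\<omega> \<in> space P. V \<omega> \<in> N_PE y v r (U \<omega>)} \<in> sets (completion P)"
proof -
  let ?T = "closed_triangle y" and ?C = "completion P"
  obtain b where b[measurable]: "\<And>m. b m \<in> borel_measurable borel"
    and b_eq: "\<And>m x. x \<in> ?T \<Longrightarrow> bary y m x = b m x"
    using bary_on_triangle_measurable[OF nc] by blast
  have U': "U \<in> borel_measurable ?C" and V': "V \<in> borel_measurable ?C"
    using U V by (auto intro: measurable_completion)
  have sets_F: "sets F = sets borel" using F by (simp add: continuous_distribution_on_def)
  \<comment> \<open>The level sets of \<open>v\<close> are measurable only for the completion of
    \<open>F\<close>. Since \<open>U\<close> has law \<open>F\<close>, preimages of
    \<open>F\<close>-null sets are \<open>P\<close>-null, so \<open>U\<close> is measurable between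
    the completions.\<close>
  have cU: "U \<in> ?C \<rightarrow>\<^sub>M completion F"
  proof (rule completion.measurable_completion2)
    show "U \<in> ?C \<rightarrow>\<^sub>M F"
      unfolding measurable_cong_sets[OF refl sets_F] by (rule U')
    have "distr ?C F U = distr ?C borel U" by (rule distr_cong) (simp_all add: sets_F)
    then have "distr ?C F U = F" by (simp add: distr_completion[OF U] dU)
    then show "null_sets F \<subseteq> null_sets (distr ?C F U)" by simp
  qed
  have vm: "{\<omega> \<in> space ?C. U \<omega> \<in> ?T - range y \<and> v (U \<omega>) = m} \<in> sets ?C" for m
    using measurable_sets[OF cU v[of m]] by (rule back_subst[where P="\<lambda>A. A \<in> sets ?C"]) auto
  have bm: "{\<omega> \<in> space ?C. 1 - b m (V \<omega>) \<le> real_of_ereal r * (1 - b m (U \<omega>))} \<in> sets ?C" for m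
    using U' V' by measurable
  \<comment> \<open>Splitting by the value \<open>m\<close> of \<open>v (U \<omega>)\<close> fixes
    the index of the barycentric coordinate, leaving conditions already known to be
    measurable.\<close>
  let ?A = "{\<omega> \<in> space ?C. r = \<infinity> \<or> (\<exists>m\<in>UNIV. (U \<omega> \<in> ?T - range y \<and> v (U \<omega>) = m) \<and>
      1 - b m (V \<omega>) \<le> real_of_ereal r * (1 - b m (U \<omega>)))}"
  have A: "?A \<in> sets ?C"
    by (intro sets.sets_Collect_disj sets.sets_Collect_const sets.sets_Collect_finite_Ex
        sets.sets_Collect_conj vm bm) simp
  note AE = continuous_distribution_on_AE[OF F]
  have "AE \<omega> in P. U \<omega> \<in> ?T - range y" "AE \<omega> in P. V \<omega> \<in> ?T - range y"
    using AE_distrD[OF U] AE_distrD[OF V] AE unfolding dU dV by blast+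
  then have "AE \<omega> in P. \<omega> \<in> ?A \<longleftrightarrow> \<omega> \<in> {\<omega> \<in> space P. V \<omega> \<in> N_PE y v r (U \<omega>)}"
    by eventually_elim (auto simp: N_PE_def b_eq)
  then show ?thesis
    \<comment> \<open>Completeness transfers measurability from \<open>?A\<close> to the event,
      which agrees with it almost everywhere.\<close>
    by (intro completion.in_sets_AE[OF _ A] AE_completion) auto
qed

theorem theorem3:
  fixes y :: "3 \<Rightarrow> real ^ 2" and M :: "real ^ 2" and v :: "real ^ 2 \<Rightarrow> 3"
    and P :: "'w measure" and X :: "nat \<Rightarrow> 'w \<Rightarrow> real ^ 2" and F :: "(real ^ 2) measure"
    and n :: nat and r1 r2 :: ereal
  assumes "\<not> collinear (range y)"
    and "M \<in> interior (closed_triangle y)"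
    and "vertex_assignment y M v"
    and "continuous_distribution_on (closed_triangle y) F"
    and "\<And>j. {x \<in> closed_triangle y - range y. v x = j} \<in> sets (completion F)"
    and "prob_space P"
    and "prob_space.indep_vars P (\<lambda>_. borel) X {1..n}"
    and "\<And>i. i \<in> {1..n} \<Longrightarrow> distr P borel (X i) = F"
    and "1 \<le> r1" and "r1 < r2"
  shows "\<forall>k :: nat.
    measure (completion P)
      {\<omega> \<in> space P. domination_number (catch_digraph (N_PE y v r2) ((\<lambda>i. X i \<omega>) ` {1..n})) \<le> k}
    \<ge> measure (completion P)
      {\<omega> \<in> space P. domination_number (catch_digraph (N_PE y v r1) ((\<lambda>i. X i \<omega>) ` {1..n})) \<le> k}"
proof
  fix k
  let ?E = "\<lambda>r. {\<omega> \<in> space P.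
    domination_number (catch_digraph (N_PE y v r) ((\<lambda>i. X i \<omega>) ` {1..n})) \<le> k}"
  interpret P: prob_space P by fact
  interpret C: prob_space "completion P" by (rule P.prob_space_completion)
  have X: "X i \<in> borel_measurable P" if "i \<in> {1..n}" for i
    using assms(7) that by (auto simp: P.indep_vars_def)
  have inT: "AE \<omega> in P. X i \<omega> \<in> closed_triangle y - range y" if "i \<in> {1..n}" for i
    using AE_distrD[OF X[OF that]] continuous_distribution_on_AE[OF assms(4)]
    unfolding assms(8)[OF that] by blast
  have "AE \<omega> in P. \<forall>i\<in>{1..n}. X i \<omega> \<in> closed_triangle y - range y"
    by (intro AE_finite_allI inT) simp_all
  then have "AE \<omega> in P. \<omega> \<in> ?E r1 \<longrightarrow> \<omega> \<in> ?E r2"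
  proof eventually_elim
    case (elim \<omega>)
    have sub: "N_PE y v r1 (X i \<omega>) \<subseteq> N_PE y v r2 (X i \<omega>)" if "i \<in> {1..n}" for i
      using N_PE_mono[OF assms(1) _ assms(9), of "X i \<omega>" r2 v] elim that assms(10) by auto
    show ?case
    proof
      assume "\<omega> \<in> ?E r1"
      then obtain S where S: "S \<subseteq> {1..n}" "card S \<le> k"
          "\<forall>j\<in>{1..n}. \<exists>i\<in>S. X j \<omega> = X i \<omega> \<or> X j \<omega> \<in> N_PE y v r1 (X i \<omega>)" and \<omega>: "\<omega> \<in> space P"
        by (auto simp: domination_number_catch_digraph_le_iff)
      \<comment> \<open>The same index set serves for both parameters, since each region only
        grows.\<close>
      have "\<forall>j\<in>{1..n}. \<exists>i\<in>S. X j \<omega> = X i \<omega> \<or> X j \<omega> \<in> N_PE y v r2 (X i \<omega>)"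
        using S(1,3) sub by (meson subset_iff)
      then show "\<omega> \<in> ?E r2"
        using S(1,2) \<omega> by (auto simp: domination_number_catch_digraph_le_iff)
    qed
  qed
  then have AE: "AE \<omega> in completion P. \<omega> \<in> ?E r1 \<longrightarrow> \<omega> \<in> ?E r2"
    by (rule AE_completion)
  \<comment> \<open>Comparing measures along an almost sure inclusion requires the larger event to
    be measurable, as \<open>measure\<close> is 0 by convention on a non-measurable set.\<close>
  have "{\<omega> \<in> space (completion P). \<exists>S \<in> Pow {1..n}. card S \<le> k \<and>
      (\<forall>j\<in>{1..n}. \<exists>i\<in>S. X j \<omega> = X i \<omega> \<or> X j \<omega> \<in> N_PE y v r2 (X i \<omega>))} \<in> sets (completion P)"
  proof (intro sets.sets_Collect_finite_Ex sets.sets_Collect_conj sets.sets_Collect_const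
      sets.sets_Collect_finite_All sets.sets_Collect_disj)
    fix S j i assume "S \<in> Pow {1..n}" "j \<in> {1..n}" "i \<in> S"
    then have ij: "i \<in> {1..n}" "j \<in> {1..n}" by auto
    have [measurable]: "X i \<in> borel_measurable P" "X j \<in> borel_measurable P"
      using X ij by auto
    have "{\<omega> \<in> space P. X j \<omega> = X i \<omega>} \<in> sets P" by measurable
    then show "{\<omega> \<in> space (completion P). X j \<omega> = X i \<omega>} \<in> sets (completion P)"
      by simp
    show "{\<omega> \<in> space (completion P). X j \<omega> \<in> N_PE y v r2 (X i \<omega>)} \<in> sets (completion P)"
      using measurable_mem_N_PE[OF assms(1,5,4) X[OF ij(1)] X[OF ij(2)]] assms(8) ij by simp
  qed (auto intro: finite_subset)
  then have "?E r2 \<in> sets (completion P)"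
    by (simp only: space_completion domination_number_catch_digraph_le_iff[OF finite_atLeastAtMost])
  then show "measure (completion P) (?E r2) \<ge> measure (completion P) (?E r1)"
    by (rule C.finite_measure_mono_AE[OF AE])
qed

end
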